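(* There exist first-order models $\mathcal M_1$ and $\mathcal M_2$ in the same vocabulary such that $\mathcal M_1$ elementarily embeds into $\mathcal M_2$, but their ultrafilter extensions $\beta(\mathcal M_1)$ and $\beta(\mathcal M_2)$ are not elementarily equivalent.
   Context: For a set $M$, an ultrafilter $D$ on $M$ and a formula $\varphi(x,\ldots)$, write $(\forall^D x)\,\varphi(x,\ldots)$ to mean $\{a\in M:\varphi(a,\ldots)\}\in D$. For a model $\mathcal M$ with universe $M$ in a vocabulary $\tau$, its ultrafilter extension $\beta(\mathcal M)$ is the $\tau$-model whose universe $\beta(M)$ is the set of all ultrafilters on $M$, where: for an $n$-ary predicate symbol $P\in\tau$ (other than equality), $P^{\beta(\mathcal M)}=\{(D_1,\ldots,D_n):(\forall^{D_1}x_1)\ldots(\forall^{D_n}x_n)\,P^{\mathcal M}(x_1,\ldots,x_n)\}$; for an $n$-ary function symbol $F\in\tau$, $F^{\beta(\mathcal M)}(D_1,\ldots,D_n)$ is the ultrafilter $D$ on $M$ such that for every $A\subseteq M$: $A\in D$ iff $(\forall^{D_1}x_1)\ldots(\forall^{D_n}x_n)\,F^{\mathcal M}(x_1,\ldots,x_n)\in A$. *)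

theory Defs
  imports Main
begin

section \<open>First-order logic with equality\<close>

text \<open>A vocabulary assigns arities to its symbols; a symbol mapped to \<open>None\<close> does not belong to
  it. Equality is a logical symbol and is not in the vocabulary.\<close>

record ('f, 'p) vocabulary =
  fun_arity :: "'f \<rightharpoonup> nat"
  pred_arity :: "'p \<rightharpoonup> nat"

datatype 'f tm = Var nat | Fn 'f "'f tm list"

datatype ('f, 'p) fm =
    Eq "'f tm" "'f tm"
  | Pred 'p "'f tm list"
  | Neg "('f, 'p) fm"
  | Conj "('f, 'p) fm" "('f, 'p) fm"
  | Exists nat "('f, 'p) fm"

fun tm_of :: "('f, 'p) vocabulary \<Rightarrow> 'f tm \<Rightarrow> bool" where
  "tm_of \<tau> (Var x) \<longleftrightarrow> True"
| "tm_of \<tau> (Fn f ts) \<longleftrightarrow> fun_arity \<tau> f = Some (length ts) \<and> (\<forall>t\<in>set ts. tm_of \<tau> t)"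

fun fm_of :: "('f, 'p) vocabulary \<Rightarrow> ('f, 'p) fm \<Rightarrow> bool" where
  "fm_of \<tau> (Eq s t) \<longleftrightarrow> tm_of \<tau> s \<and> tm_of \<tau> t"
| "fm_of \<tau> (Pred p ts) \<longleftrightarrow> pred_arity \<tau> p = Some (length ts) \<and> (\<forall>t\<in>set ts. tm_of \<tau> t)"
| "fm_of \<tau> (Neg \<phi>) \<longleftrightarrow> fm_of \<tau> \<phi>"
| "fm_of \<tau> (Conj \<phi> \<psi>) \<longleftrightarrow> fm_of \<tau> \<phi> \<and> fm_of \<tau> \<psi>"
| "fm_of \<tau> (Exists x \<phi>) \<longleftrightarrow> fm_of \<tau> \<phi>"

fun fv_tm :: "'f tm \<Rightarrow> nat set" where
  "fv_tm (Var x) = {x}"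
| "fv_tm (Fn f ts) = (\<Union>t\<in>set ts. fv_tm t)"

fun fv :: "('f, 'p) fm \<Rightarrow> nat set" where
  "fv (Eq s t) = fv_tm s \<union> fv_tm t"
| "fv (Pred p ts) = (\<Union>t\<in>set ts. fv_tm t)"
| "fv (Neg \<phi>) = fv \<phi>"
| "fv (Conj \<phi> \<psi>) = fv \<phi> \<union> fv \<psi>"
| "fv (Exists x \<phi>) = fv \<phi> - {x}"

definition sentence_of :: "('f, 'p) vocabulary \<Rightarrow> ('f, 'p) fm \<Rightarrow> bool" where
  "sentence_of \<tau> \<phi> \<longleftrightarrow> fm_of \<tau> \<phi> \<and> fv \<phi> = {}"

text \<open>Only the values of \<open>fun_interp\<close> and \<open>pred_interp\<close> at symbols of the vocabulary, applied to
  argument lists over the universe whose length is the arity, are meaningful.\<close>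

record ('f, 'p, 'a) model =
  universe :: "'a set"
  fun_interp :: "'f \<Rightarrow> 'a list \<Rightarrow> 'a"
  pred_interp :: "'p \<Rightarrow> 'a list \<Rightarrow> bool"

definition is_model :: "('f, 'p) vocabulary \<Rightarrow> ('f, 'p, 'a) model \<Rightarrow> bool" where
  "is_model \<tau> \<M> \<longleftrightarrow> universe \<M> \<noteq> {} \<and>
    (\<forall>f n as. fun_arity \<tau> f = Some n \<longrightarrow> length as = n \<longrightarrow> set as \<subseteq> universe \<M> \<longrightarrow>
      fun_interp \<M> f as \<in> universe \<M>)"

fun tm_val :: "('f, 'p, 'a) model \<Rightarrow> (nat \<Rightarrow> 'a) \<Rightarrow> 'f tm \<Rightarrow> 'a" where
  "tm_val \<M> v (Var x) = v x"
| "tm_val \<M> v (Fn f ts) = fun_interp \<M> f (map (tm_val \<M> v) ts)"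

fun sat :: "('f, 'p, 'a) model \<Rightarrow> (nat \<Rightarrow> 'a) \<Rightarrow> ('f, 'p) fm \<Rightarrow> bool" where
  "sat \<M> v (Eq s t) \<longleftrightarrow> tm_val \<M> v s = tm_val \<M> v t"
| "sat \<M> v (Pred p ts) \<longleftrightarrow> pred_interp \<M> p (map (tm_val \<M> v) ts)"
| "sat \<M> v (Neg \<phi>) \<longleftrightarrow> \<not> sat \<M> v \<phi>"
| "sat \<M> v (Conj \<phi> \<psi>) \<longleftrightarrow> sat \<M> v \<phi> \<and> sat \<M> v \<psi>"
| "sat \<M> v (Exists x \<phi>) \<longleftrightarrow> (\<exists>a\<in>universe \<M>. sat \<M> (v(x := a)) \<phi>)"

text \<open>For a sentence the quantification over assignments is immaterial, see
  \<open>holds_sentence_iff\<close> below.\<close>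

definition holds :: "('f, 'p, 'a) model \<Rightarrow> ('f, 'p) fm \<Rightarrow> bool" where
  "holds \<M> \<phi> \<longleftrightarrow> (\<forall>v. range v \<subseteq> universe \<M> \<longrightarrow> sat \<M> v \<phi>)"

definition elementarily_equivalent ::
  "('f, 'p) vocabulary \<Rightarrow> ('f, 'p, 'a) model \<Rightarrow> ('f, 'p, 'b) model \<Rightarrow> bool" where
  "elementarily_equivalent \<tau> \<M> \<N> \<longleftrightarrow> (\<forall>\<phi>. sentence_of \<tau> \<phi> \<longrightarrow> (holds \<M> \<phi> \<longleftrightarrow> holds \<N> \<phi>))"

definition elementary_embedding ::
  "('f, 'p) vocabulary \<Rightarrow> ('f, 'p, 'a) model \<Rightarrow> ('f, 'p, 'b) model \<Rightarrow> ('a \<Rightarrow> 'b) \<Rightarrow> bool" where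
  "elementary_embedding \<tau> \<M> \<N> h \<longleftrightarrow> h ` universe \<M> \<subseteq> universe \<N> \<and>
    (\<forall>\<phi> v. fm_of \<tau> \<phi> \<longrightarrow> range v \<subseteq> universe \<M> \<longrightarrow> (sat \<M> v \<phi> \<longleftrightarrow> sat \<N> (h \<circ> v) \<phi>))"

definition elementarily_embeds ::
  "('f, 'p) vocabulary \<Rightarrow> ('f, 'p, 'a) model \<Rightarrow> ('f, 'p, 'b) model \<Rightarrow> bool" where
  "elementarily_embeds \<tau> \<M> \<N> \<longleftrightarrow> (\<exists>h. elementary_embedding \<tau> \<M> \<N> h)"

lemma tm_val_cong: "(\<And>x. x \<in> fv_tm t \<Longrightarrow> v x = w x) \<Longrightarrow> tm_val \<M> v t = tm_val \<M> w t"
proof (induction t)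
  case (Fn f ts)
  then have "map (tm_val \<M> v) ts = map (tm_val \<M> w) ts" by (intro map_cong) auto
  then show ?case by (simp only: tm_val.simps)
qed simp

lemma sat_cong: "(\<And>x. x \<in> fv \<phi> \<Longrightarrow> v x = w x) \<Longrightarrow> sat \<M> v \<phi> \<longleftrightarrow> sat \<M> w \<phi>"
proof (induction \<phi> arbitrary: v w)
  case (Eq s t)
  then have "tm_val \<M> v s = tm_val \<M> w s" "tm_val \<M> v t = tm_val \<M> w t"
    by (auto intro: tm_val_cong)
  then show ?case by simp
next
  case (Pred p ts)
  then have "map (tm_val \<M> v) ts = map (tm_val \<M> w) ts"
    by (auto intro!: tm_val_cong)
  then show ?case by (simp only: sat.simps)
next
  case (Neg \<phi>)
  then show ?case by (metis fv.simps(3) sat.simps(3))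
next
  case (Conj \<phi> \<psi>)
  then show ?case by (metis UnCI fv.simps(4) sat.simps(4))
next
  case (Exists x \<phi>)
  have "sat \<M> (v(x := a)) \<phi> \<longleftrightarrow> sat \<M> (w(x := a)) \<phi>" for a
    using Exists.prems by (intro Exists.IH) auto
  then show ?case by simp
qed

lemma holds_sentence_iff:
  assumes "fv \<phi> = {}" "range v \<subseteq> universe \<M>"
  shows "holds \<M> \<phi> \<longleftrightarrow> sat \<M> v \<phi>"
  unfolding holds_def using assms sat_cong[of \<phi>] by (metis empty_iff)

lemma elementary_embedding_inj_on:
  assumes "elementary_embedding \<tau> \<M> \<N> h"
  shows "inj_on h (universe \<M>)"
proof (rule inj_onI)
  fix a b assume ab: "a \<in> universe \<M>" "b \<in> universe \<M>" "h a = h b"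
  define v where "v = (\<lambda>n::nat. if n = 0 then a else b)"
  have "range v \<subseteq> universe \<M>" using ab by (auto simp: v_def)
  then have "sat \<M> v (Eq (Var 0) (Var 1)) \<longleftrightarrow> sat \<N> (h \<circ> v) (Eq (Var 0) (Var 1))"
    using assms unfolding elementary_embedding_def by (metis fm_of.simps(1) tm_of.simps(1))
  then show "a = b" using ab by (simp add: v_def)
qed


section \<open>Ultrafilter extensions\<close>

definition ultrafilter_on :: "'a set \<Rightarrow> 'a set set \<Rightarrow> bool" where
  "ultrafilter_on M D \<longleftrightarrow> D \<subseteq> Pow M \<and> M \<in> D \<and> {} \<notin> D \<and>
    (\<forall>A\<in>D. \<forall>B\<in>D. A \<inter> B \<in> D) \<and>
    (\<forall>A\<in>D. \<forall>B. A \<subseteq> B \<longrightarrow> B \<subseteq> M \<longrightarrow> B \<in> D) \<and>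
    (\<forall>A. A \<subseteq> M \<longrightarrow> A \<in> D \<or> M - A \<in> D)"

text \<open>\<open>all_uf M [D\<^sub>1, \<dots>, D\<^sub>n] \<phi>\<close> is the iterated quantifier
  \<open>(\<forall>\<^bsup>D\<^sub>1\<^esup> x\<^sub>1) \<dots> (\<forall>\<^bsup>D\<^sub>n\<^esup> x\<^sub>n) \<phi> [x\<^sub>1, \<dots>, x\<^sub>n]\<close>, with \<open>D\<^sub>1\<close> outermost.\<close>

fun all_uf :: "'a set \<Rightarrow> 'a set set list \<Rightarrow> ('a list \<Rightarrow> bool) \<Rightarrow> bool" where
  "all_uf M [] \<phi> \<longleftrightarrow> \<phi> []"
| "all_uf M (D # Ds) \<phi> \<longleftrightarrow> {a \<in> M. all_uf M Ds (\<lambda>as. \<phi> (a # as))} \<in> D"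

definition ultrafilter_extension ::
  "('f, 'p, 'a) model \<Rightarrow> ('f, 'p, 'a set set) model" ("\<beta>") where
  "\<beta> \<M> = \<lparr>
    universe = {D. ultrafilter_on (universe \<M>) D},
    fun_interp = (\<lambda>f Ds. {A. A \<subseteq> universe \<M> \<and>
      all_uf (universe \<M>) Ds (\<lambda>as. fun_interp \<M> f as \<in> A)}),
    pred_interp = (\<lambda>p Ds. all_uf (universe \<M>) Ds (pred_interp \<M> p))\<rparr>"

text \<open>The set interpreting a function symbol is indeed an ultrafilter, so \<open>\<beta> \<M>\<close> is a model.\<close>

lemma all_uf_cong:
  assumes "\<And>as. length as = length Ds \<Longrightarrow> set as \<subseteq> M \<Longrightarrow> \<phi> as \<longleftrightarrow> \<psi> as"
  shows "all_uf M Ds \<phi> \<longleftrightarrow> all_uf M Ds \<psi>"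
  using assms
proof (induction Ds arbitrary: \<phi> \<psi>)
  case (Cons D Ds)
  have "{a \<in> M. all_uf M Ds (\<lambda>as. \<phi> (a # as))} = {a \<in> M. all_uf M Ds (\<lambda>as. \<psi> (a # as))}"
    using Cons.prems by (intro Collect_cong conj_cong refl Cons.IH) auto
  then show ?case by simp
qed simp

lemma all_uf_conj:
  assumes "\<forall>D\<in>set Ds. ultrafilter_on M D"
  shows "all_uf M Ds (\<lambda>as. \<phi> as \<and> \<psi> as) \<longleftrightarrow> all_uf M Ds \<phi> \<and> all_uf M Ds \<psi>"
  using assms
proof (induction Ds arbitrary: \<phi> \<psi>)
  case (Cons D Ds)
  let ?A = "{a \<in> M. all_uf M Ds (\<lambda>as. \<phi> (a # as))}"
  let ?B = "{a \<in> M. all_uf M Ds (\<lambda>as. \<psi> (a # as))}"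
  have D: "ultrafilter_on M D" using Cons.prems by simp
  have eq: "{a \<in> M. all_uf M Ds (\<lambda>as. \<phi> (a # as) \<and> \<psi> (a # as))} = ?A \<inter> ?B"
    using Cons by auto
  have "?A \<inter> ?B \<in> D \<longleftrightarrow> ?A \<in> D \<and> ?B \<in> D"
  proof
    assume AB: "?A \<inter> ?B \<in> D"
    have sup: "B \<in> D" if "?A \<inter> ?B \<subseteq> B" "B \<subseteq> M" for B
      using D AB that unfolding ultrafilter_on_def by blast
    show "?A \<in> D \<and> ?B \<in> D" by (intro conjI sup) blast+
  qed (use D in \<open>simp add: ultrafilter_on_def\<close>)
  then show ?case using eq by simp
qed simp

lemma all_uf_not:
  assumes "\<forall>D\<in>set Ds. ultrafilter_on M D"
  shows "all_uf M Ds (\<lambda>as. \<not> \<phi> as) \<longleftrightarrow> \<not> all_uf M Ds \<phi>"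
  using assms
proof (induction Ds arbitrary: \<phi>)
  case (Cons D Ds)
  let ?A = "{a \<in> M. all_uf M Ds (\<lambda>as. \<phi> (a # as))}"
  have D: "ultrafilter_on M D" using Cons.prems by simp
  have eq: "{a \<in> M. all_uf M Ds (\<lambda>as. \<not> \<phi> (a # as))} = M - ?A"
    using Cons by auto
  have "M - ?A \<in> D \<longleftrightarrow> ?A \<notin> D"
  proof
    assume "M - ?A \<in> D"
    then have "?A \<in> D \<Longrightarrow> ?A \<inter> (M - ?A) \<in> D" using D unfolding ultrafilter_on_def by blast
    moreover have "?A \<inter> (M - ?A) = {}" by blast
    ultimately show "?A \<notin> D" using D unfolding ultrafilter_on_def by metis
  next
    assume "?A \<notin> D"
    moreover have "?A \<subseteq> M" by blast
    ultimately show "M - ?A \<in> D" using D unfolding ultrafilter_on_def by metis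
  qed
  then show ?case using eq by simp
qed simp

lemma all_uf_True:
  assumes "\<forall>D\<in>set Ds. ultrafilter_on M D"
  shows "all_uf M Ds (\<lambda>_. True)"
  using assms by (induction Ds) (auto simp: ultrafilter_on_def)

lemma is_model_ultrafilter_extension:
  assumes "is_model \<tau> \<M>"
  shows "is_model \<tau> (\<beta> \<M>)"
proof -
  let ?M = "universe \<M>"
  obtain a where "a \<in> ?M" using assms by (auto simp: is_model_def)
  then have "ultrafilter_on ?M {A. A \<subseteq> ?M \<and> a \<in> A}" by (auto simp: ultrafilter_on_def)
  then have ne: "universe (\<beta> \<M>) \<noteq> {}" by (auto simp: ultrafilter_extension_def)
  have "fun_interp (\<beta> \<M>) f Ds \<in> universe (\<beta> \<M>)"
    if ar: "fun_arity \<tau> f = Some (length Ds)" and Ds: "set Ds \<subseteq> universe (\<beta> \<M>)" for f Ds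
  proof -
    let ?Q = "\<lambda>A. all_uf ?M Ds (\<lambda>as. fun_interp \<M> f as \<in> A)"
    have uf: "\<forall>D\<in>set Ds. ultrafilter_on ?M D"
      using Ds by (auto simp: ultrafilter_extension_def)
    have mem: "fun_interp \<M> f as \<in> ?M" if "length as = length Ds" "set as \<subseteq> ?M" for as
      using assms ar that by (auto simp: is_model_def)
    have "?Q ?M \<longleftrightarrow> all_uf ?M Ds (\<lambda>_. True)"
      by (rule all_uf_cong) (simp add: mem)
    then have top: "?Q ?M" using all_uf_True[OF uf] by simp
    have compl: "?Q (?M - A) \<longleftrightarrow> \<not> ?Q A" for A
    proof -
      have "?Q (?M - A) \<longleftrightarrow> all_uf ?M Ds (\<lambda>as. fun_interp \<M> f as \<notin> A)"
        by (rule all_uf_cong) (simp add: mem)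
      then show ?thesis using all_uf_not[OF uf] by simp
    qed
    have inter: "?Q (A \<inter> B) \<longleftrightarrow> ?Q A \<and> ?Q B" for A B
      using all_uf_conj[OF uf] by simp
    have bot: "\<not> ?Q {}" using compl[of ?M] top by simp
    have mono: "?Q B" if "?Q A" "A \<subseteq> B" for A B
      using inter[of A B] that by (simp only: Int_absorb2 simp_thms)
    have "ultrafilter_on ?M {A. A \<subseteq> ?M \<and> ?Q A}"
      unfolding ultrafilter_on_def
    proof (intro conjI ballI allI impI)
      fix A B assume "A \<in> {A. A \<subseteq> ?M \<and> ?Q A}" "A \<subseteq> B" "B \<subseteq> ?M"
      then show "B \<in> {A. A \<subseteq> ?M \<and> ?Q A}" using mono[of A B] by simp
    qed (use top bot in \<open>auto simp: inter compl simp del: Int_iff Diff_iff\<close>)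
    then show ?thesis by (simp add: ultrafilter_extension_def)
  qed
  then show ?thesis using ne by (auto simp: is_model_def)
qed

end

theory Submission
  imports Defs Complex_Main "HOL-Library.Countable"
begin

text \<open>Let the vocabulary consist of two binary predicate symbols, interpreted as the strict order
  and as equality. The line without a point and the full line are dense orders without endpoints,
  so the inclusion is elementary by back and forth. Because equality is also an ordinary predicate,
  the principal ultrafilters are definable in the extension as those related to themselves by it.
  Hence a first-order sentence about the extension can say that some ultrafilter lies between two
  principal ones but converges to no principal one. On the punctured line an ultrafilter converging
  to the missing point does this; on the full line the supremum of the points below
  the ultrafilter prevents it.\<close>

section \<open>Ultrafilters\<close>

definition fip :: "'a set set \<Rightarrow> bool" where
  "fip G \<longleftrightarrow> (\<forall>S. finite S \<longrightarrow> S \<subseteq> G \<longrightarrow> S \<noteq> {} \<longrightarrow> \<Inter>S \<noteq> {})"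

lemma fip_Union_chain:
  assumes "subset.chain {G. fip G} C"
  shows "fip (\<Union>C)"
  unfolding fip_def
proof (intro allI impI)
  fix S assume S: "finite S" "S \<subseteq> \<Union>C" "S \<noteq> {}"
  have "C \<noteq> {}" using S by auto
  then obtain G where "G \<in> C" "S \<subseteq> G"
    using finite_subset_Union_chain[OF S(1,2) _ assms] by auto
  moreover have "fip G" using assms \<open>G \<in> C\<close> by (auto simp: subset.chain_def)
  ultimately show "\<Inter>S \<noteq> {}" using S by (auto simp: fip_def)
qed

text \<open>Zorn's lemma yields a maximal family with the finite intersection property. Maximality
  puts into it every subset of \<open>M\<close> that meets all its finite intersections, and the
  ultrafilter axioms follow from this criterion.\<close>

lemma ultrafilter_on_exists:
  assumes F: "fip F" "F \<subseteq> Pow M" and M: "M \<noteq> {}"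
  shows "\<exists>D. ultrafilter_on M D \<and> F \<subseteq> D"
proof -
  let ?A = "{G. F \<subseteq> G \<and> G \<subseteq> Pow M \<and> fip G}"
  have "\<exists>U\<in>?A. \<forall>X\<in>?A. U \<subseteq> X \<longrightarrow> X = U"
  proof (rule subset_Zorn_nonempty)
    show "?A \<noteq> {}" using F by auto
    fix C assume C: "C \<noteq> {}" "subset.chain ?A C"
    have "subset.chain {G. fip G} C" using C(2) by (auto simp: subset.chain_def)
    from fip_Union_chain[OF this] show "\<Union>C \<in> ?A"
      using C by (fastforce simp: subset.chain_def)
  qed
  then obtain D where D: "F \<subseteq> D" "D \<subseteq> Pow M" "fip D"
    and max: "\<And>X. F \<subseteq> X \<Longrightarrow> X \<subseteq> Pow M \<Longrightarrow> fip X \<Longrightarrow> D \<subseteq> X \<Longrightarrow> X = D" by auto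
  have mem: "A \<in> D"
    if A: "A \<subseteq> M" "\<And>S. finite S \<Longrightarrow> S \<subseteq> D \<Longrightarrow> A \<inter> \<Inter>S \<noteq> {}" for A
  proof -
    have "fip (insert A D)"
      unfolding fip_def
    proof (intro allI impI)
      fix S assume S: "finite S" "S \<subseteq> insert A D" "S \<noteq> {}"
      have "A \<inter> \<Inter>(S - {A}) \<noteq> {}" using S by (intro A(2)) auto
      then show "\<Inter>S \<noteq> {}" by auto
    qed
    then have "insert A D = D" using D A(1) by (intro max) auto
    then show ?thesis by auto
  qed
  have M_in: "M \<in> D"
  proof (rule mem)
    fix S assume S: "finite S" "S \<subseteq> D"
    show "M \<inter> \<Inter>S \<noteq> {}"
    proof (cases "S = {}")
      case False
      then have "\<Inter>S \<noteq> {}" using S D(3) unfolding fip_def by blast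
      moreover have "\<Inter>S \<subseteq> M" using False S D(2) by blast
      ultimately show ?thesis by blast
    qed (use M in simp)
  qed simp
  have sup: "B \<in> D" if "finite T" "T \<subseteq> D" "\<Inter>T \<subseteq> B" "B \<subseteq> M" "T \<noteq> {}" for B T
  proof (rule mem)
    fix S assume "finite S" "S \<subseteq> D"
    then have "\<Inter>(T \<union> S) \<noteq> {}" using that D(3) unfolding fip_def by blast
    then show "B \<inter> \<Inter>S \<noteq> {}" using that by blast
  qed (use that in simp)
  have "A \<in> D \<or> M - A \<in> D" if A: "A \<subseteq> M" for A
  proof (rule ccontr)
    assume "\<not> (A \<in> D \<or> M - A \<in> D)"
    then have "A \<notin> D" "M - A \<notin> D" by auto
    then obtain S T where ST: "finite S" "S \<subseteq> D" "A \<inter> \<Inter>S = {}"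
      "finite T" "T \<subseteq> D" "(M - A) \<inter> \<Inter>T = {}"
      using mem[OF A] mem[OF Diff_subset[of M A]] by blast
    \<comment> \<open>Inserting \<open>M\<close> keeps the family nonempty even if \<open>S\<close>
      and \<open>T\<close> are empty, and forces the common point into \<open>M\<close>, where it
      must miss either \<open>A\<close> or its complement.\<close>
    have "\<Inter>(insert M (S \<union> T)) \<noteq> {}" using ST M_in D(3) unfolding fip_def by (metis
      Un_subset_iff finite_UnI finite_insert insert_not_empty insert_subset)
    then obtain x where "x \<in> M" "x \<in> \<Inter>S" "x \<in> \<Inter>T" by auto
    then show False using ST(3,6) by (cases "x \<in> A") blast+
  qed
  moreover have "A \<inter> B \<in> D" if "A \<in> D" "B \<in> D" for A B
    using that D(2) by (intro sup[of "{A, B}"]) auto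
  moreover have "B \<in> D" if "A \<in> D" "A \<subseteq> B" "B \<subseteq> M" for A B
    using that by (intro sup[of "{A}"]) auto
  moreover have "{} \<notin> D" using D(3) by (auto simp: fip_def dest: spec[of _ "{{}}"])
  ultimately have "ultrafilter_on M D" using D(2) M_in by (auto simp: ultrafilter_on_def)
  then show ?thesis using D(1) by blast
qed

section \<open>Principal ultrafilters and their definability\<close>

definition principal :: "'a set \<Rightarrow> 'a \<Rightarrow> 'a set set" where
  "principal M a = {A. A \<subseteq> M \<and> a \<in> A}"

lemma ultrafilter_on_principal: "a \<in> M \<Longrightarrow> ultrafilter_on M (principal M a)"
  by (auto simp: ultrafilter_on_def principal_def)

lemma ultrafilter_on_eq_principal:
  assumes "ultrafilter_on M D" "{a} \<in> D"
  shows "D = principal M a"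
proof -
  have "A \<in> D \<longleftrightarrow> a \<in> A" if "A \<subseteq> M" for A
  proof
    assume "A \<in> D"
    then have "A \<inter> {a} \<in> D" using assms unfolding ultrafilter_on_def by blast
    then have "A \<inter> {a} \<noteq> {}" using assms unfolding ultrafilter_on_def by metis
    then show "a \<in> A" by blast
  next
    assume "a \<in> A"
    then have "{a} \<subseteq> A" by simp
    then show "A \<in> D" using assms that unfolding ultrafilter_on_def by blast
  qed
  moreover have "D \<subseteq> Pow M" using assms by (simp add: ultrafilter_on_def)
  ultimately show ?thesis unfolding principal_def by blast
qed

text \<open>The inner set is a singleton, and only a principal ultrafilter contains one. So
  equality, extended as a predicate, is no longer reflexive at nonprincipal ultrafilters.\<close>

lemma all_uf_eq_diag_iff:
  assumes D: "ultrafilter_on M D"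
  shows "all_uf M [D, D] (\<lambda>as. as ! 0 = as ! 1) \<longleftrightarrow> (\<exists>a\<in>M. D = principal M a)"
proof -
  have sing: "{b \<in> M. a = b} = {a}" if "a \<in> M" for a using that by auto
  have "{a \<in> M. {b \<in> M. a = b} \<in> D} \<in> D \<longleftrightarrow> (\<exists>a\<in>M. D = principal M a)"
  proof
    assume "{a \<in> M. {b \<in> M. a = b} \<in> D} \<in> D"
    then have "{a \<in> M. {b \<in> M. a = b} \<in> D} \<noteq> {}" using D unfolding ultrafilter_on_def by metis
    then obtain a where "a \<in> M" "{a} \<in> D" using sing by auto
    then show "\<exists>a\<in>M. D = principal M a" using ultrafilter_on_eq_principal[OF D] by blast
  qed (auto simp: principal_def)
  then show ?thesis by simp
qed

section \<open>Dense orders without endpoints\<close>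

text \<open>The lower Dedekind cut, with rationals numbered by \<open>from_nat\<close>. It places
  the real line inside \<open>nat set\<close>, the element type of both models.\<close>

definition cut :: "real \<Rightarrow> nat set" where
  "cut x = {n. of_rat (from_nat n) < x}"

lemma cut_mono_iff: "cut x \<subseteq> cut y \<longleftrightarrow> x \<le> y"
proof
  assume sub: "cut x \<subseteq> cut y"
  show "x \<le> y"
  proof (rule ccontr)
    assume "\<not> x \<le> y"
    then obtain q where "y < of_rat q" "of_rat q < x" using of_rat_dense[of y x] by auto
    then have "to_nat q \<in> cut x" "to_nat q \<notin> cut y" by (auto simp: cut_def)
    then show False using sub by blast
  qed
qed (auto simp: cut_def)

lemma cut_psubset_iff [simp]: "cut x \<subset> cut y \<longleftrightarrow> x < y"
  by (auto simp: less_le_not_le cut_mono_iff)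

lemma cut_eq_iff [simp]: "cut x = cut y \<longleftrightarrow> x = y"
  by (auto simp: set_eq_subset cut_mono_iff)

definition ord_voc :: "(nat, nat) vocabulary" where
  "ord_voc = \<lparr>fun_arity = Map.empty, pred_arity = (\<lambda>p. if p \<le> 1 then Some 2 else None)\<rparr>"

text \<open>The order of the reals becomes strict inclusion of cuts; the vocabulary has no function
  symbols, so \<open>fun_interp\<close> is irrelevant.\<close>

definition ord_model :: "real set \<Rightarrow> (nat, nat, nat set) model" where
  "ord_model A = \<lparr>universe = cut ` A, fun_interp = (\<lambda>_ _. {}),
    pred_interp = (\<lambda>p as. if p = 0 then as ! 0 \<subset> as ! 1 else as ! 0 = as ! 1)\<rparr>"

lemma is_model_ord_model: "A \<noteq> {} \<Longrightarrow> is_model ord_voc (ord_model A)"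
  by (simp add: is_model_def ord_voc_def ord_model_def)

text \<open>Since \<open>L\<close> and \<open>U\<close> may be empty, one condition covers
  nonemptiness, density and the absence of endpoints.\<close>

definition interpolating :: "'a::linorder set \<Rightarrow> bool" where
  "interpolating A \<longleftrightarrow> (\<forall>L U. finite L \<longrightarrow> finite U \<longrightarrow> (\<forall>l\<in>L. \<forall>u\<in>U. l < u) \<longrightarrow>
    (\<exists>a\<in>A. (\<forall>l\<in>L. l < a) \<and> (\<forall>u\<in>U. a < u)))"

lemma interpolating_cofinite:
  fixes A :: "real set"
  assumes "finite (- A)"
  shows "interpolating A"
  unfolding interpolating_def
proof (intro allI impI)
  fix L U :: "real set"
  assume LU: "finite L" "finite U" "\<forall>l\<in>L. \<forall>u\<in>U. l < u"
  obtain x y where xy: "x < y" "\<forall>l\<in>L. l \<le> x" "\<forall>u\<in>U. y \<le> u"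
  proof -
    \<comment> \<open>The default values only serve to keep \<open>x < y\<close> when one or both
      sides impose no bound.\<close>
    define y where "y = (if U = {} then (if L = {} then 0 else Max L + 1) else Min U)"
    define x where "x = (if L = {} then y - 1 else Max L)"
    have "x < y"
    proof (cases "L = {} \<or> U = {}")
      case True
      then have "y = x + 1" by (auto simp: x_def y_def)
      then show ?thesis by simp
    next
      case False
      then show ?thesis using LU by (auto simp: x_def y_def)
    qed
    moreover have "\<forall>l\<in>L. l \<le> x" "\<forall>u\<in>U. y \<le> u" using LU by (auto simp: x_def y_def)
    ultimately show ?thesis using that by blast
  qed
  have "infinite {x<..<y}" using xy(1) by (simp add: infinite_Ioo)
  then have "\<not> {x<..<y} \<subseteq> - A" using assms finite_subset by blast
  then obtain a where "a \<in> A" "x < a" "a < y" by auto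
  then show "\<exists>a\<in>A. (\<forall>l\<in>L. l < a) \<and> (\<forall>u\<in>U. a < u)" using xy by force
qed

text \<open>A single move of the back-and-forth game: a new point \<open>x\<close> on one side is
  answered by a point \<open>y\<close> in the same position relative to the finitely many points
  already chosen.\<close>

lemma order_extension_step:
  fixes v :: "'i \<Rightarrow> 'a::linorder" and w :: "'i \<Rightarrow> 'b::linorder"
  assumes "interpolating B" "finite I" "\<forall>i\<in>I. w i \<in> B" "\<forall>i\<in>I. \<forall>j\<in>I. v i < v j \<longleftrightarrow> w i < w j"
  shows "\<exists>y\<in>B. \<forall>i\<in>I. (v i < x \<longleftrightarrow> w i < y) \<and> (x < v i \<longleftrightarrow> y < w i)"
proof (cases "\<exists>i\<in>I. v i = x")
  case True
  \<comment> \<open>If \<open>x\<close> is already some \<open>v i\<close>, the answer is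
    \<open>w i\<close>.\<close>
  then show ?thesis using assms by blast
next
  case False
  let ?L = "w ` {i\<in>I. v i < x}" and ?U = "w ` {i\<in>I. x < v i}"
  have "\<forall>l\<in>?L. \<forall>u\<in>?U. l < u" using assms(4) by (auto dest: less_trans)
  moreover have "finite ?L" "finite ?U" using assms(2) by auto
  ultimately have "\<exists>y\<in>B. (\<forall>l\<in>?L. l < y) \<and> (\<forall>u\<in>?U. y < u)"
    using assms(1) unfolding interpolating_def by presburger
  then obtain y where y: "y \<in> B" "\<forall>l\<in>?L. l < y" "\<forall>u\<in>?U. y < u" by blast
  have "(v i < x \<longleftrightarrow> w i < y) \<and> (x < v i \<longleftrightarrow> y < w i)" if "i \<in> I" for i
    using False y(2,3) that by (cases "v i" x rule: linorder_cases) (auto dest: less_asym)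
  then show ?thesis using y(1) by blast
qed

section \<open>Transfer of truth by back and forth\<close>

lemma finite_fv_tm: "finite (fv_tm t)"
  by (induction t) auto

lemma finite_fv: "finite (fv \<phi>)"
  by (induction \<phi>) (auto simp: finite_fv_tm)

lemma tm_of_ord_vocE: "tm_of ord_voc t \<Longrightarrow> (\<And>x. t = Var x \<Longrightarrow> P) \<Longrightarrow> P"
  by (cases t) (auto simp: ord_voc_def)

text \<open>Truth depends only on the order type of the values of the free variables. Equalities are
  covered too, because the orders are linear. At a quantifier, \<open>order_extension_step\<close>
  is used in both directions.\<close>

lemma sat_ord_model_cong:
  assumes "interpolating A" "interpolating B" "fm_of ord_voc \<phi>"
    "\<forall>i\<in>fv \<phi>. v i \<in> A" "\<forall>i\<in>fv \<phi>. w i \<in> B"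
    "\<forall>i\<in>fv \<phi>. \<forall>j\<in>fv \<phi>. v i < v j \<longleftrightarrow> w i < w j"
  shows "sat (ord_model A) (cut \<circ> v) \<phi> \<longleftrightarrow> sat (ord_model B) (cut \<circ> w) \<phi>"
  using assms(3-)
proof (induction \<phi> arbitrary: v w)
  case (Eq s t)
  then show ?case by (auto elim!: tm_of_ord_vocE)
next
  case (Pred p ts)
  then have "length ts = 2" by (auto simp: ord_voc_def split: if_splits)
  then obtain s t where "ts = [s, t]" by (auto simp: length_Suc_conv numeral_2_eq_2)
  with Pred obtain i j where "ts = [Var i, Var j]" by (auto elim!: tm_of_ord_vocE)
  then show ?case using Pred.prems by (auto simp: ord_model_def)
next
  case (Conj \<phi> \<psi>)
  have "sat (ord_model A) (cut \<circ> v) \<phi> \<longleftrightarrow> sat (ord_model B) (cut \<circ> w) \<phi>"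
    using Conj.prems by (intro Conj.IH) auto
  moreover have "sat (ord_model A) (cut \<circ> v) \<psi> \<longleftrightarrow> sat (ord_model B) (cut \<circ> w) \<psi>"
    using Conj.prems by (intro Conj.IH) auto
  ultimately show ?case by (simp only: sat.simps)
next
  case (Exists n \<phi>)
  let ?I = "fv \<phi> - {n}"
  have fin: "finite ?I" by (simp add: finite_fv)
  have upd: "(cut \<circ> u)(n := cut x) = cut \<circ> (u(n := x))" for u x by (simp add: fun_eq_iff)
  have sat_iff: "sat (ord_model A) (cut \<circ> v(n := x)) \<phi> \<longleftrightarrow> sat (ord_model B) (cut \<circ> w(n := y)) \<phi>"
    if "x \<in> A" "y \<in> B" "\<forall>i\<in>?I. (v i < x \<longleftrightarrow> w i < y) \<and> (x < v i \<longleftrightarrow> y < w i)" for x y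
    using Exists.prems that by (intro Exists.IH) auto
  have "\<exists>y\<in>B. \<forall>i\<in>?I. (v i < x \<longleftrightarrow> w i < y) \<and> (x < v i \<longleftrightarrow> y < w i)" for x
    using Exists.prems by (intro order_extension_step[OF assms(2) fin]) auto
  moreover have "\<exists>x\<in>A. \<forall>i\<in>?I. (w i < y \<longleftrightarrow> v i < x) \<and> (y < w i \<longleftrightarrow> x < v i)" for y
    using Exists.prems by (intro order_extension_step[OF assms(1) fin]) auto
  ultimately have "(\<exists>x\<in>A. sat (ord_model A) (cut \<circ> v(n := x)) \<phi>) \<longleftrightarrow>
      (\<exists>y\<in>B. sat (ord_model B) (cut \<circ> w(n := y)) \<phi>)"
    using sat_iff by metis
  moreover have "universe (ord_model C) = cut ` C" for C by (simp add: ord_model_def)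
  ultimately show ?case by (simp only: sat.simps bex_simps upd)
qed auto

lemma elementary_embedding_ord_model:
  assumes "interpolating A" "interpolating B" "A \<subseteq> B"
  shows "elementary_embedding ord_voc (ord_model A) (ord_model B) id"
  unfolding elementary_embedding_def
proof (intro conjI allI impI)
  show "id ` universe (ord_model A) \<subseteq> universe (ord_model B)"
    using assms(3) by (auto simp: ord_model_def)
  fix \<phi> and v :: "nat \<Rightarrow> nat set"
  assume \<phi>: "fm_of ord_voc \<phi>" and "range v \<subseteq> universe (ord_model A)"
  then have "\<forall>n. \<exists>x\<in>A. v n = cut x" by (auto simp: ord_model_def)
  then obtain u where u: "\<And>n. u n \<in> A" "\<And>n. v n = cut (u n)" by metis
  then have "v = cut \<circ> u" by auto
  then show "sat (ord_model A) v \<phi> \<longleftrightarrow> sat (ord_model B) (id \<circ> v) \<phi>"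
    using sat_ord_model_cong[OF assms(1,2) \<phi>, of u u] u(1) assms(3) by auto
qed

section \<open>A sentence detecting gaps\<close>

abbreviation Lt_fm :: "nat \<Rightarrow> nat \<Rightarrow> (nat, nat) fm" where
  "Lt_fm x y \<equiv> Pred 0 [Var x, Var y]"

text \<open>On the diagonal, symbol 1 singles out the principal ultrafilters, so in the extension
  this quantifies over the points of the line.\<close>

definition Ex_principal :: "nat \<Rightarrow> (nat, nat) fm \<Rightarrow> (nat, nat) fm" where
  "Ex_principal x \<phi> = Exists x (Conj (Pred 1 [Var x, Var x]) \<phi>)"

text \<open>Variable 0 is the ultrafilter. Its bounds come first; then variable 1 is a candidate
  limit, and variable 2 a point strictly between that candidate and the ultrafilter. The nested
  negations encode a universal quantifier and a disjunction.\<close>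

definition gap_sentence :: "(nat, nat) fm" where
  "gap_sentence = Exists 0 (Conj (Ex_principal 1 (Lt_fm 1 0)) (Conj (Ex_principal 1 (Lt_fm 0 1))
    (Neg (Ex_principal 1 (Neg (Ex_principal 2 (Neg (Conj
      (Neg (Conj (Lt_fm 2 1) (Lt_fm 0 2))) (Neg (Conj (Lt_fm 1 2) (Lt_fm 2 0)))))))))))"

lemma sentence_of_gap_sentence: "sentence_of ord_voc gap_sentence"
  by (auto simp: sentence_of_def gap_sentence_def Ex_principal_def ord_voc_def)

section \<open>Meaning of the sentence in the extensions\<close>

abbreviation pr :: "real set \<Rightarrow> real \<Rightarrow> nat set set set" where
  "pr A x \<equiv> principal (cut ` A) (cut x)"

lemma sat_Ex_principal:
  "sat (\<beta> (ord_model A)) v (Ex_principal n \<phi>) \<longleftrightarrow>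
    (\<exists>x\<in>A. sat (\<beta> (ord_model A)) (v(n := pr A x)) \<phi>)"
proof -
  have "sat (\<beta> (ord_model A)) v (Ex_principal n \<phi>) \<longleftrightarrow>
    (\<exists>D. (ultrafilter_on (cut ` A) D \<and> all_uf (cut ` A) [D, D] (\<lambda>as. as ! 0 = as ! 1)) \<and>
      sat (\<beta> (ord_model A)) (v(n := D)) \<phi>)"
    by (simp add: Ex_principal_def ultrafilter_extension_def ord_model_def)
  moreover have "ultrafilter_on (cut ` A) D \<and> all_uf (cut ` A) [D, D] (\<lambda>as. as ! 0 = as ! 1) \<longleftrightarrow>
      (\<exists>x\<in>A. D = pr A x)" for D
    using all_uf_eq_diag_iff[of "cut ` A" D] ultrafilter_on_principal[of _ "cut ` A"] by blast
  ultimately show ?thesis by (simp only:) blast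
qed

definition above :: "real set \<Rightarrow> real \<Rightarrow> nat set set" where
  "above A x = cut ` {y\<in>A. x < y}"

definition below :: "real set \<Rightarrow> real \<Rightarrow> nat set set" where
  "below A x = cut ` {y\<in>A. y < x}"

text \<open>A quantifier over a principal ultrafilter evaluates at its point, so the iterated
  quantifiers collapse to one membership in \<open>D\<close>.\<close>

lemma pred_interp_principal_left:
  assumes "x \<in> A" "ultrafilter_on (cut ` A) D"
  shows "pred_interp (\<beta> (ord_model A)) 0 [pr A x, D] \<longleftrightarrow> above A x \<in> D"
proof -
  have "{b \<in> cut ` A. cut y \<subset> b} = above A y" for y
    by (auto simp: above_def del: psubsetI psubsetE)
  then show ?thesis using assms
    by (auto simp: ultrafilter_extension_def ord_model_def principal_def)
qed

lemma pred_interp_principal_right: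
  assumes "x \<in> A" "ultrafilter_on (cut ` A) D"
  shows "pred_interp (\<beta> (ord_model A)) 0 [D, pr A x] \<longleftrightarrow> below A x \<in> D"
proof -
  have "{a \<in> cut ` A. {b \<in> cut ` A. a \<subset> b} \<in> pr A x} = below A x"
    using assms(1) by (auto simp: below_def principal_def del: psubsetI psubsetE)
  then show ?thesis by (simp add: ultrafilter_extension_def ord_model_def)
qed

lemma below_mem_principal_iff: "y \<in> A \<Longrightarrow> below A x \<in> pr A y \<longleftrightarrow> y < x"
  by (auto simp: below_def principal_def)

lemma sat_gap_sentence:
  "sat (\<beta> (ord_model A)) v gap_sentence \<longleftrightarrow>
    (\<exists>D. ultrafilter_on (cut ` A) D \<and> (\<exists>l\<in>A. above A l \<in> D) \<and> (\<exists>u\<in>A. below A u \<in> D) \<and>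
      (\<forall>c\<in>A. \<exists>a\<in>A. a < c \<and> below A a \<in> D \<or> c < a \<and> above A a \<in> D))"
proof -
  have uni: "universe (\<beta> (ord_model A)) = {D. ultrafilter_on (cut ` A) D}"
    by (simp add: ultrafilter_extension_def ord_model_def)
  \<comment> \<open>Written with the same negations as the sentence, so that the congruence rules
    match it piece by piece.\<close>
  let ?N = "\<lambda>D c a. \<not> (\<not> (a < c \<and> below A a \<in> D) \<and> \<not> (c < a \<and> above A a \<in> D))"
  have "sat (\<beta> (ord_model A)) v gap_sentence \<longleftrightarrow>
    (\<exists>D\<in>{D. ultrafilter_on (cut ` A) D}. (\<exists>l\<in>A. above A l \<in> D) \<and> (\<exists>u\<in>A. below A u \<in> D) \<and>
      \<not> (\<exists>c\<in>A. \<not> (\<exists>a\<in>A. ?N D c a)))"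
    unfolding gap_sentence_def sat.simps sat_Ex_principal uni
    by (intro bex_cong conj_cong arg_cong[where f = Not] refl)
      (simp_all add: pred_interp_principal_left pred_interp_principal_right
        below_mem_principal_iff ultrafilter_on_principal)
  then show ?thesis by simp
qed

text \<open>By completeness, the points having \<open>D\<close> above them possess a supremum, and
  no point can separate this supremum from \<open>D\<close>.\<close>

lemma not_sat_gap_sentence_line: "\<not> sat (\<beta> (ord_model UNIV)) v gap_sentence"
proof
  assume "sat (\<beta> (ord_model UNIV)) v gap_sentence"
  then obtain D l u where D: "ultrafilter_on (cut ` UNIV) D"
    and l: "above UNIV l \<in> D" and u: "below UNIV u \<in> D"
    and gap: "\<And>c. \<exists>a. a < c \<and> below UNIV a \<in> D \<or> c < a \<and> above UNIV a \<in> D"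
    unfolding sat_gap_sentence by auto
  have less: "a < b" if "above UNIV a \<in> D" "below UNIV b \<in> D" for a b
  proof -
    have "above UNIV a \<inter> below UNIV b \<noteq> {}" using D that unfolding ultrafilter_on_def by metis
    then show ?thesis by (auto simp: above_def below_def)
  qed
  let ?L = "{a. above UNIV a \<in> D}"
  have bdd: "bdd_above ?L" using less[OF _ u] by (intro bdd_aboveI[of _ u]) (auto intro: less_imp_le)
  from gap[of "Sup ?L"] obtain a
    where "a < Sup ?L \<and> below UNIV a \<in> D \<or> Sup ?L < a \<and> above UNIV a \<in> D" by blast
  then show False
  proof
    assume a: "a < Sup ?L \<and> below UNIV a \<in> D"
    \<comment> \<open>A point below the supremum is exceeded by some \<open>b\<close> with
      \<open>D\<close> above it, so \<open>D\<close> cannot also lie below \<open>a\<close>.\<close>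
    then obtain b where "above UNIV b \<in> D" "a < b" using less_cSup_iff[OF _ bdd] l by auto
    then show False using less[of b a] a by simp
  next
    assume "Sup ?L < a \<and> above UNIV a \<in> D"
    then show False using cSup_upper[OF _ bdd, of a] by simp
  qed
qed

text \<open>The intervals \<open>(0, e)\<close> generate a filter converging to the missing point
  from the right; any ultrafilter containing them is a witness.\<close>

lemma sat_gap_sentence_punctured_line: "sat (\<beta> (ord_model (- {0}))) v gap_sentence"
proof -
  let ?A = "- {0} :: real set"
  let ?F = "(\<lambda>e. cut ` {0<..<e}) ` {0<..}"
  have "fip ?F"
    unfolding fip_def
  proof (intro allI impI)
    fix S assume "finite S" "S \<subseteq> ?F" "S \<noteq> {}"
    then obtain E where E: "finite E" "E \<subseteq> {0<..}" "S = (\<lambda>e. cut ` {0<..<e}) ` E" "E \<noteq> {}"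
      by (metis (no_types, lifting) finite_subset_image image_is_empty)
    have "Min E > 0" using E by auto
    then obtain x where "0 < x" "x < Min E" using dense by blast
    then have "cut x \<in> \<Inter>S" using E by auto
    then show "\<Inter>S \<noteq> {}" by blast
  qed
  moreover have "?F \<subseteq> Pow (cut ` ?A)" by (intro image_subsetI PowI image_mono) auto
  moreover have "cut 1 \<in> cut ` ?A" by (intro imageI) simp
  then have "cut ` ?A \<noteq> {}" by blast
  ultimately have "\<exists>D. ultrafilter_on (cut ` ?A) D \<and> ?F \<subseteq> D" by (rule ultrafilter_on_exists)
  then obtain D where D: "ultrafilter_on (cut ` ?A) D" "?F \<subseteq> D" by blast
  have sup: "Y \<in> D" if "cut ` {0<..<e} \<subseteq> Y" "Y \<subseteq> cut ` ?A" "e > 0" for Y e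
  proof -
    have "cut ` {0<..<e} \<in> D" using D(2) that(3) by auto
    then show ?thesis using D(1) that(1,2) unfolding ultrafilter_on_def by blast
  qed
  have above: "above ?A a \<in> D" if "a < 0" for a
    using that by (intro sup[of 1]) (auto simp: above_def)
  have below: "below ?A a \<in> D" if "a > 0" for a
    using that by (intro sup[of a]) (auto simp: below_def)
  \<comment> \<open>The midpoint \<open>c / 2\<close> lies strictly between \<open>c\<close> and the
    missing 0, hence separates \<open>c\<close> from \<open>D\<close> on either side.\<close>
  have "\<exists>a\<in>?A. a < c \<and> below ?A a \<in> D \<or> c < a \<and> above ?A a \<in> D" if "c \<in> ?A" for c
    using that above[of "c / 2"] below[of "c / 2"]
    by (intro bexI[of _ "c / 2"]) (cases "c < 0"; auto)+
  moreover have "\<exists>l\<in>?A. above ?A l \<in> D" using above[of "-1"] by (intro bexI[of _ "-1"]) auto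
  moreover have "\<exists>u\<in>?A. below ?A u \<in> D" using below[of 1] by (intro bexI[of _ 1]) auto
  ultimately show ?thesis unfolding sat_gap_sentence using D(1) by blast
qed

theorem theorem2:
  "\<exists>(\<tau> :: (nat, nat) vocabulary)
     (\<M>\<^sub>1 :: (nat, nat, nat set) model) (\<M>\<^sub>2 :: (nat, nat, nat set) model).
     is_model \<tau> \<M>\<^sub>1 \<and> is_model \<tau> \<M>\<^sub>2 \<and>
     elementarily_embeds \<tau> \<M>\<^sub>1 \<M>\<^sub>2 \<and>
     \<not> elementarily_equivalent \<tau> (\<beta> \<M>\<^sub>1) (\<beta> \<M>\<^sub>2)"
proof (intro exI conjI)
  let ?M1 = "ord_model (- {0})" and ?M2 = "ord_model UNIV"
  show "is_model ord_voc ?M1" 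
    by (rule is_model_ord_model) (use ComplI[of 1 "{0::real}"] in force)
  show M2: "is_model ord_voc ?M2" by (rule is_model_ord_model) simp
  show "elementarily_embeds ord_voc ?M1 ?M2"
    unfolding elementarily_embeds_def
    by (rule exI, rule elementary_embedding_ord_model) (auto intro: interpolating_cofinite)
  \<comment> \<open>Refuting \<open>holds\<close> requires an actual assignment into the extension;
    a constant one suffices.\<close>
  obtain D where "D \<in> universe (\<beta> ?M2)"
    using is_model_ultrafilter_extension[OF M2] by (auto simp: is_model_def)
  then have "range (\<lambda>_::nat. D) \<subseteq> universe (\<beta> ?M2)" by auto
  then have "\<not> holds (\<beta> ?M2) gap_sentence"
    using not_sat_gap_sentence_line unfolding holds_def by blast
  moreover have "holds (\<beta> ?M1) gap_sentence"
    using sat_gap_sentence_punctured_line unfolding holds_def by blast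
  ultimately show "\<not> elementarily_equivalent ord_voc (\<beta> ?M1) (\<beta> ?M2)"
    using sentence_of_gap_sentence unfolding elementarily_equivalent_def by blast
qed

end
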